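(* For $d \geq 2$, let $H_r^- = \{\mathbf{x} \in \mathbb{R}^d : x_1 + \ldots + x_d \leq r\}$ denote the negative half space with parameter $0 \leq r \leq d$, and let $V_d^- : [0,d] \to [0,1]$ with $V_d^-(r) = \mathrm{vol}\left([0,1]^d \cap H_r^-\right)$. If $\Phi$ is the cumulative distribution function of the standard normal distribution, then $$V_d^-(r) \rightarrow \Phi\left( 2\sqrt{3d}\left( \frac{r}{d} - \frac{1}{2} \right) \right)$$ as $d \to \infty$ for all $r > 0$, i.e., $V_d^-$ converges pointwise to $\Phi$.
   Context: Here $d$ is an integer (the dimension), $\mathbf{x} = (x_1, \ldots, x_d)$, $[0,1]^d$ is the $d$-dimensional unit cube, and $\mathrm{vol}$ denotes $d$-dimensional volume (Lebesgue measure). *)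

theory Defs
  imports "HOL-Probability.Probability"
begin

text \<open>
  As the dimension varies, points of \<open>\<real>\<^sup>d\<close> are functions on the index set \<open>{1..d}\<close>
  (extensional, i.e. \<open>undefined\<close> outside it), and \<open>d\<close>-dimensional volume is the \<open>d\<close>-fold
  product of one-dimensional Lebesgue measure.
\<close>

definition vol_space :: "nat \<Rightarrow> (nat \<Rightarrow> real) measure" where
  "vol_space d = Pi\<^sub>M {1..d} (\<lambda>_. lborel)"

definition unit_cube :: "nat \<Rightarrow> (nat \<Rightarrow> real) set" where
  "unit_cube d = {1..d} \<rightarrow>\<^sub>E {0..1}"

definition neg_half_space :: "nat \<Rightarrow> real \<Rightarrow> (nat \<Rightarrow> real) set" where
  "neg_half_space d r = {x \<in> space (vol_space d). (\<Sum>i=1..d. x i) \<le> r}"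

text \<open>
  Only \<open>0 \<le> r \<le> d\<close> is of interest; for other \<open>r\<close> the value is that of the same formula
  (\<open>0\<close> for \<open>r < 0\<close>, \<open>1\<close> for \<open>r > d\<close>).  For fixed \<open>r \<ge> 0\<close>, all \<open>d \<ge> r\<close> are within this range.
\<close>

definition V_neg :: "nat \<Rightarrow> real \<Rightarrow> real" where
  "V_neg d r = measure (vol_space d) (unit_cube d \<inter> neg_half_space d r)"

definition Phi :: "real \<Rightarrow> real" where
  "Phi = cdf std_normal_distribution"

lemma sets_unit_cube [measurable]: "unit_cube d \<in> sets (vol_space d)"
  unfolding unit_cube_def vol_space_def by (rule sets_PiM_I_finite) auto

lemma sets_neg_half_space [measurable]: "neg_half_space d r \<in> sets (vol_space d)"
  unfolding neg_half_space_def vol_space_def by measurable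

lemma emeasure_unit_cube: "emeasure (vol_space d) (unit_cube d) = 1"
proof -
  interpret product_sigma_finite "\<lambda>_::nat. lborel :: real measure" ..
  show ?thesis
    unfolding unit_cube_def vol_space_def by (subst emeasure_PiM) auto
qed

lemma V_neg_range: "V_neg d r \<in> {0..1}"
proof -
  have "emeasure (vol_space d) (unit_cube d \<inter> neg_half_space d r) \<le> 1"
    using emeasure_mono[of "unit_cube d \<inter> neg_half_space d r" "unit_cube d" "vol_space d"]
    by (simp add: emeasure_unit_cube)
  then have "V_neg d r \<le> 1"
    unfolding V_neg_def measure_def using enn2real_mono[of _ 1] by fastforce
  then show ?thesis
    by (simp add: V_neg_def)
qed

end

theory Submission
  imports Defs "HOL-Real_Asymp.Real_Asymp"
begin

text \<open>
  Volume inside the unit cube is a probability: restricted to the cube, Lebesgue measure is the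
  product of \<open>d\<close> uniform distributions on \<open>[0,1]\<close>, so \<open>V_neg d r\<close> is the probability that
  \<open>d\<close> independent uniform variables have a sum of at most \<open>r\<close> (\<open>uniform_measure_PiM\<close>,
  \<open>V_neg_eq_prob_uniform_sum\<close>).  Such a sum has mean \<open>d / 2\<close> and variance \<open>d / 12\<close>, and
  standardizing the threshold \<open>r\<close> gives exactly
  \<open>(r - d / 2) / sqrt (d / 12) = 2 * sqrt (3 * d) * (r / d - 1 / 2)\<close>.  Hence, for \<open>d > 0\<close>, \<open>V_neg d r\<close> is the
  distribution function of the standardized sum at this point (\<open>V_neg_eq_cdf\<close>).

  To have one probability space for all dimensions, the variables are the coordinates of
  an infinite product of uniform distributions.  There the central limit theorem applies.  For a
  fixed standardized threshold \<open>t\<close> it gives the limit \<open>Phi t\<close>, because \<open>Phi\<close> is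
  continuous.  For a fixed \<open>r\<close> the standardized threshold tends to \<open>-\<infinity>\<close>, which pointwise
  convergence of distribution functions does not cover directly; but monotonicity bounds the
  values by those at any fixed \<open>t\<close>, so \<open>V_neg d r\<close> tends to \<open>0\<close>
  (\<open>weak_conv_m_cdf_at_bot\<close>), as does \<open>Phi\<close> at the standardized threshold.
\<close>

section \<open>Uniform distributions on boxes\<close>

text \<open>
  Normalizing to a box commutes with products, since the measure of an intersection of boxes is the
  product over the coordinates and so is the normalizing factor.
\<close>

lemma uniform_measure_PiM:
  assumes "finite I" and sigma: "\<And>i. sigma_finite_measure (M i)"
    and A: "\<And>i. A i \<in> sets (M i)"
    and A_pos: "\<And>i. emeasure (M i) (A i) \<noteq> 0"
    and A_fin: "\<And>i. emeasure (M i) (A i) \<noteq> \<infinity>"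
  shows "uniform_measure (Pi\<^sub>M I M) (Pi\<^sub>E I A) = Pi\<^sub>M I (\<lambda>i. uniform_measure (M i) (A i))"
proof -
  interpret M: product_sigma_finite M
    using sigma by (simp add: product_sigma_finite_def)
  interpret U: product_prob_space "\<lambda>i. uniform_measure (M i) (A i)" I
    using A_pos A_fin by (intro product_prob_spaceI prob_space_uniform_measure)
  show ?thesis
  proof (rule U.PiM_eqI)
    show "sets (uniform_measure (Pi\<^sub>M I M) (Pi\<^sub>E I A)) = sets (Pi\<^sub>M I (\<lambda>i. uniform_measure (M i) (A i)))"
      by (simp cong: sets_PiM_cong)
    fix B assume "\<And>i. i \<in> I \<Longrightarrow> B i \<in> sets (uniform_measure (M i) (A i))"
    then have B: "B i \<in> sets (M i)" if "i \<in> I" for i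
      using that by simp
    have "emeasure (uniform_measure (Pi\<^sub>M I M) (Pi\<^sub>E I A)) (Pi\<^sub>E I B)
        = emeasure (Pi\<^sub>M I M) (Pi\<^sub>E I A \<inter> Pi\<^sub>E I B) / emeasure (Pi\<^sub>M I M) (Pi\<^sub>E I A)"
      using \<open>finite I\<close> A B by (intro emeasure_uniform_measure sets_PiM_I_finite) auto
    also have "\<dots> = (\<Prod>i\<in>I. emeasure (M i) (A i \<inter> B i)) / (\<Prod>i\<in>I. emeasure (M i) (A i))"
      using \<open>finite I\<close> A B by (simp add: PiE_Int M.emeasure_PiM sets.Int)
    also have "\<dots> = (\<Prod>i\<in>I. emeasure (M i) (A i \<inter> B i) / emeasure (M i) (A i))"
      using \<open>finite I\<close>
    proof (induction I)
      case (insert i I)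
      have "(\<Prod>i\<in>I. emeasure (M i) (A i)) \<noteq> \<infinity>"
        using A_fin by (simp add: ennreal_prod_eq_top)
      \<comment> \<open>Finiteness of both factors rules out a product of \<open>0\<close> and \<open>\<infinity>\<close>, where inversion is not
        multiplicative.\<close>
      then have "inverse (emeasure (M i) (A i) * (\<Prod>i\<in>I. emeasure (M i) (A i)))
          = inverse (emeasure (M i) (A i)) * inverse (\<Prod>i\<in>I. emeasure (M i) (A i))"
        using A_fin by (intro ennreal_inverse_mult) (auto simp: top.not_eq_extremum)
      with insert show ?case
        by (simp add: divide_ennreal_def mult_ac)
    qed (simp add: divide_ennreal_def)
    also have "\<dots> = (\<Prod>i\<in>I. emeasure (uniform_measure (M i) (A i)) (B i))"
      using A B by (intro prod.cong) auto
    finally show "emeasure (uniform_measure (Pi\<^sub>M I M) (Pi\<^sub>E I A)) (Pi\<^sub>E I B)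
        = (\<Prod>i\<in>I. emeasure (uniform_measure (M i) (A i)) (B i))" .
  qed (fact \<open>finite I\<close>)
qed

section \<open>The cube as a probability space\<close>

definition uniform01 :: "real measure" where
  "uniform01 = uniform_measure lborel {0..1}"

definition uniform_seq :: "(nat \<Rightarrow> real) measure" where
  "uniform_seq = Pi\<^sub>M UNIV (\<lambda>_. uniform01)"

lemma sets_uniform01 [measurable_cong, simp]: "sets uniform01 = sets borel"
  by (simp add: uniform01_def)

lemma space_uniform01 [simp]: "space uniform01 = UNIV"
  by (simp add: uniform01_def)

interpretation uniform01: prob_space uniform01
  unfolding uniform01_def by (rule prob_space_uniform_measure) auto

interpretation uniform_seq: product_prob_space "\<lambda>_::nat. uniform01" UNIV
  by unfold_locales

lemma prob_space_uniform_seq: "prob_space uniform_seq"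
  unfolding uniform_seq_def by (rule uniform_seq.prob_space_axioms)

lemma measurable_uniform_seq_component [measurable]: "(\<lambda>\<omega>. \<omega> i) \<in> borel_measurable uniform_seq"
  unfolding uniform_seq_def
  using measurable_component_singleton[of i UNIV "\<lambda>_. uniform01"]
  by (simp cong: measurable_cong_sets)

text \<open>
  The cube has volume \<open>1\<close>, so conditioning Lebesgue measure on it leaves volumes inside it
  unchanged; the box formula identifies the conditioned measure as a product of uniform
  distributions, which is the marginal of \<open>uniform_seq\<close> on the coordinates \<open>{1..d}\<close>.  The sum is
  written over \<open>{..<d}\<close>, with shifted coordinates, to be a partial sum of one sequence of variables
  that starts at index \<open>0\<close>.
\<close>

lemma V_neg_eq_prob_uniform_sum:
  "V_neg d r = measure uniform_seq {\<omega>. (\<Sum>i<d. \<omega> (Suc i)) \<le> r}"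
proof -
  let ?P = "Pi\<^sub>M {1..d} (\<lambda>_. uniform01)"
  have "uniform_measure (vol_space d) (unit_cube d) = ?P"
    unfolding vol_space_def unit_cube_def uniform01_def
    by (rule uniform_measure_PiM) (auto intro: lborel.sigma_finite_measure_axioms)
  moreover have "measure (vol_space d) (unit_cube d) = 1"
    by (simp add: measure_def emeasure_unit_cube)
  then have "measure (uniform_measure (vol_space d) (unit_cube d)) (neg_half_space d r)
      = V_neg d r"
    by (simp add: V_neg_def emeasure_unit_cube sets_neg_half_space)
  ultimately have "V_neg d r = measure ?P (neg_half_space d r)"
    by simp
  also have "\<dots> = measure uniform_seq
      (prod_emb UNIV (\<lambda>_. uniform01) {1..d} (neg_half_space d r))"
  proof -
    have "sets (vol_space d) = sets ?P"
      unfolding vol_space_def by (rule sets_PiM_cong) auto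
    then have "neg_half_space d r \<in> sets ?P"
      using sets_neg_half_space[of d r] by simp
    then show ?thesis
      unfolding uniform_seq_def measure_def by (simp add: uniform_seq.emeasure_PiM_emb')
  qed
  also have "prod_emb UNIV (\<lambda>_. uniform01) {1..d} (neg_half_space d r)
      = {\<omega>. (\<Sum>i<d. \<omega> (Suc i)) \<le> r}"
  proof -
    have "(\<Sum>i=1..d. f i) = (\<Sum>i<d. f (Suc i))" for f :: "nat \<Rightarrow> real"
      by (rule sum.reindex_bij_witness[of _ Suc "\<lambda>i. i - 1"]) auto
    then show ?thesis
      by (auto simp: prod_emb_def neg_half_space_def vol_space_def space_PiM)
  qed
  finally show ?thesis .
qed

section \<open>The central limit theorem for uniform variables\<close>

lemma distr_uniform_seq_component: "distr uniform_seq borel (\<lambda>\<omega>. \<omega> i) = uniform01"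
proof -
  have "distr uniform_seq borel (\<lambda>\<omega>. \<omega> i) = distr uniform_seq uniform01 (\<lambda>\<omega>. \<omega> i)"
    by (rule distr_cong) auto
  also have "\<dots> = uniform01"
    unfolding uniform_seq_def by (rule uniform_seq.PiM_component) simp
  finally show ?thesis .
qed

lemma indep_vars_uniform_seq: "prob_space.indep_vars uniform_seq (\<lambda>_. borel) (\<lambda>i \<omega>. \<omega> (Suc i)) UNIV"
proof -
  interpret prob_space uniform_seq by (rule prob_space_uniform_seq)
  have "distr uniform_seq (Pi\<^sub>M UNIV (\<lambda>_. borel)) (\<lambda>\<omega>. \<lambda>i\<in>UNIV. \<omega> (Suc i))
      = distr uniform_seq (Pi\<^sub>M UNIV (\<lambda>_. uniform01)) (\<lambda>\<omega>. \<lambda>i\<in>UNIV. \<omega> (Suc i))"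
    by (intro distr_cong sets_PiM_cong) auto
  also have "\<dots> = Pi\<^sub>M UNIV (\<lambda>_. uniform01)"
    unfolding uniform_seq_def
    by (rule distr_PiM_reindex) (auto intro: uniform01.prob_space_axioms)
  finally show ?thesis
    by (subst indep_vars_iff_distr_eq_PiM') (auto simp: distr_uniform_seq_component)
qed

lemma distributed_uniform_seq_component:
  "distributed uniform_seq lborel (\<lambda>\<omega>. \<omega> i) (\<lambda>x. indicator {0..1} x / measure lborel {0..1::real})"
proof -
  have "distr uniform_seq lborel (\<lambda>\<omega>. \<omega> i) = distr uniform_seq borel (\<lambda>\<omega>. \<omega> i)"
    by (rule distr_cong) auto
  also have "\<dots> = density lborel (\<lambda>x. ennreal (indicator {0..1} x / measure lborel {0..1::real}))"
    unfolding distr_uniform_seq_component uniform01_def uniform_measure_def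
    by (intro density_cong) (auto split: split_indicator)
  finally show ?thesis
    by (auto simp: distributed_def)
qed

definition std_uniform_sum :: "nat \<Rightarrow> (nat \<Rightarrow> real) \<Rightarrow> real" where
  "std_uniform_sum d \<omega> = (\<Sum>i<d. \<omega> (Suc i) - 1 / 2) / sqrt (real d * (1 / 12))"

lemma measurable_std_uniform_sum [measurable]: "std_uniform_sum d \<in> borel_measurable uniform_seq"
  unfolding std_uniform_sum_def by measurable

lemma weak_conv_std_uniform_sum:
  "weak_conv_m (\<lambda>d. distr uniform_seq borel (std_uniform_sum d)) std_normal_distribution"
proof -
  interpret prob_space uniform_seq by (rule prob_space_uniform_seq)
  have integrable_square: "integrable uniform_seq (\<lambda>\<omega>. (\<omega> i)\<^sup>2)" for i
  proof -
    have "AE x in uniform01. x \<in> {0..1}"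
      unfolding uniform01_def by (rule AE_uniform_measureI) auto
    then have "AE \<omega> in uniform_seq. \<omega> i \<in> {0..1}"
      unfolding uniform_seq_def by (intro uniform_seq.AE_component) auto
    then have "AE \<omega> in uniform_seq. norm ((\<omega> i)\<^sup>2) \<le> 1"
      by eventually_elim (auto simp: power_le_one)
    then show ?thesis
      by (rule integrable_const_bound) simp
  qed
  have "weak_conv_m
      (\<lambda>d. distr uniform_seq borel
        (\<lambda>\<omega>. (\<Sum>i<d. \<omega> (Suc i) - 1 / 2) / sqrt (real d * (sqrt (1 / 12))\<^sup>2)))
      std_normal_distribution"
  proof (rule central_limit_theorem[where \<mu> = uniform01])
    show "expectation (\<lambda>\<omega>. \<omega> (Suc n)) = 1 / 2" for n
      using uniform_distributed_expectation[OF distributed_uniform_seq_component] by simp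
    show "variance (\<lambda>\<omega>. \<omega> (Suc n)) = (sqrt (1 / 12))\<^sup>2" for n
      using uniform_distributed_variance[OF distributed_uniform_seq_component] by simp
  qed (simp_all add: indep_vars_uniform_seq integrable_square distr_uniform_seq_component)
  then show ?thesis
    by (simp add: std_uniform_sum_def[abs_def])
qed

lemma V_neg_eq_cdf:
  assumes "d > 0"
  shows "V_neg d r
    = cdf (distr uniform_seq borel (std_uniform_sum d)) (2 * sqrt (3 * real d) * (r / real d - 1 / 2))"
proof -
  have sqrt_12: "sqrt 12 = 2 * sqrt 3"
    using real_sqrt_mult[of 4 3] by simp
  have threshold: "2 * sqrt (3 * real d) * (r / real d - 1 / 2)
      = (r - real d / 2) / sqrt (real d * (1 / 12))"
  proof -
    have "sqrt (real d) * (r / real d - 1 / 2) = (r - real d / 2) * (sqrt (real d) / real d)"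
      using assms by (simp add: field_simps)
    also have "sqrt (real d) / real d = 1 / sqrt (real d)"
      using assms by (simp add: field_simps)
    finally have "sqrt (real d) * (r / real d - 1 / 2) = (r - real d / 2) / sqrt (real d)"
      by simp
    then have "2 * sqrt 3 * (sqrt (real d) * (r / real d - 1 / 2))
        = 2 * sqrt 3 * ((r - real d / 2) / sqrt (real d))"
      by (rule arg_cong)
    then show ?thesis
      by (simp add: real_sqrt_mult real_sqrt_divide sqrt_12 mult_ac)
  qed
  have "{\<omega>. (\<Sum>i<d. \<omega> (Suc i)) \<le> r}
      = std_uniform_sum d -` {..2 * sqrt (3 * real d) * (r / real d - 1 / 2)} \<inter> space uniform_seq"
    using assms unfolding threshold
    by (auto simp: std_uniform_sum_def sum_subtractf divide_le_cancel uniform_seq_def space_PiM)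
  then show ?thesis
    by (simp add: V_neg_eq_prob_uniform_sum cdf_def measure_distr)
qed

section \<open>Limits of distribution functions\<close>

lemma isCont_Phi: "isCont Phi t"
proof -
  interpret real_distribution std_normal_distribution by (rule real_dist_normal_dist)
  have "emeasure std_normal_distribution {t} = 0"
    by (subst emeasure_density) (auto simp: nn_integral_0_iff_AE AE_lborel_singleton)
  then show ?thesis
    by (simp add: Phi_def isCont_cdf measure_def)
qed

lemma Phi_at_bot: "(Phi \<longlongrightarrow> 0) at_bot"
  unfolding Phi_def
  by (intro finite_borel_measure.cdf_lim_at_bot real_distribution.finite_borel_measure_M
      real_dist_normal_dist)

text \<open>
  Mass cannot escape to \<open>-\<infinity>\<close>: eventually \<open>s n \<le> t\<close>, so monotonicity bounds the values along
  \<open>s\<close> by the values at any fixed \<open>t\<close>, and the limit there is small when \<open>t\<close>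
  is far to the left.
\<close>

lemma weak_conv_m_cdf_at_bot:
  assumes conv: "weak_conv_m M N"
    and M: "\<And>n. real_distribution (M n)" and N: "real_distribution N"
    and cont: "\<And>x. isCont (cdf N) x"
    and s: "filterlim s at_bot sequentially"
  shows "(\<lambda>n. cdf (M n) (s n)) \<longlonglongrightarrow> 0"
proof (rule order_tendstoI)
  have nonneg: "0 \<le> cdf (M n) x" for n x
    by (simp add: cdf_def)
  show "\<forall>\<^sub>F n in sequentially. a < cdf (M n) (s n)" if "a < 0" for a
    using that nonneg by (intro always_eventually) (auto intro: less_le_trans)
  fix e :: real assume "0 < e"
  have "(cdf N \<longlongrightarrow> 0) at_bot"
    by (intro finite_borel_measure.cdf_lim_at_bot real_distribution.finite_borel_measure_M N)
  then have "\<forall>\<^sub>F t in at_bot. cdf N t < e"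
    using \<open>0 < e\<close> by (rule order_tendstoD)
  then obtain t where t: "cdf N t < e"
    by (metis eventually_happens' trivial_limit_at_bot_linorder)
  have "(\<lambda>n. cdf (M n) t) \<longlonglongrightarrow> cdf N t"
    using conv cont by (simp add: weak_conv_m_def weak_conv_def)
  then have "\<forall>\<^sub>F n in sequentially. cdf (M n) t < e"
    using t by (rule order_tendstoD)
  moreover have "\<forall>\<^sub>F n in sequentially. s n \<le> t"
    using s by (simp add: filterlim_at_bot)
  ultimately show "\<forall>\<^sub>F n in sequentially. cdf (M n) (s n) < e"
  proof eventually_elim
    case (elim n)
    have "cdf (M n) (s n) \<le> cdf (M n) t"
      by (intro finite_borel_measure.cdf_nondecreasing
          real_distribution.finite_borel_measure_M M elim)
    with elim show ?case by simp
  qed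
qed

theorem theorem2:
  shows "(\<forall>r::real. r > 0 \<longrightarrow>
            (\<lambda>d::nat. V_neg d r - Phi (2 * sqrt (3 * real d) * (r / real d - 1 / 2)))
              \<longlonglongrightarrow> 0)
       \<and> (\<forall>t::real. \<forall>r::nat \<Rightarrow> real.
            (\<forall>d\<ge>2. 2 * sqrt (3 * real d) * (r d / real d - 1 / 2) = t) \<longrightarrow>
            (\<lambda>d. V_neg d (r d)) \<longlonglongrightarrow> Phi t)"
proof (intro conjI allI impI)
  fix r :: real
  let ?s = "\<lambda>d. 2 * sqrt (3 * real d) * (r / real d - 1 / 2)"
  let ?F = "\<lambda>d. cdf (distr uniform_seq borel (std_uniform_sum d))"
  have s: "filterlim ?s at_bot sequentially"
    by real_asymp
  have "(\<lambda>d. ?F d (?s d)) \<longlonglongrightarrow> 0"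
  proof (rule weak_conv_m_cdf_at_bot[OF weak_conv_std_uniform_sum _ real_dist_normal_dist _ s])
    show "real_distribution (distr uniform_seq borel (std_uniform_sum d))" for d
      by (intro prob_space.real_distribution_distr prob_space_uniform_seq) simp
    show "isCont (cdf std_normal_distribution) x" for x
      using isCont_Phi by (simp add: Phi_def)
  qed
  then have "(\<lambda>d. V_neg d r) \<longlonglongrightarrow> 0"
    by (rule Lim_transform_eventually)
      (use eventually_gt_at_top[of 0] in \<open>eventually_elim, simp add: V_neg_eq_cdf\<close>)
  moreover have "(\<lambda>d. Phi (?s d)) \<longlonglongrightarrow> 0"
    using Phi_at_bot s by (rule filterlim_compose)
  ultimately show "(\<lambda>d. V_neg d r - Phi (?s d)) \<longlonglongrightarrow> 0"
    using tendsto_diff by fastforce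
next
  fix t :: real and r :: "nat \<Rightarrow> real"
  assume r: "\<forall>d\<ge>2. 2 * sqrt (3 * real d) * (r d / real d - 1 / 2) = t"
  have "(\<lambda>d. cdf (distr uniform_seq borel (std_uniform_sum d)) t) \<longlonglongrightarrow> Phi t"
    using weak_conv_std_uniform_sum isCont_Phi
    by (simp add: weak_conv_m_def weak_conv_def Phi_def)
  moreover have "\<forall>\<^sub>F d in sequentially.
      cdf (distr uniform_seq borel (std_uniform_sum d)) t = V_neg d (r d)"
    using eventually_ge_at_top[of 2] by eventually_elim (use r in \<open>simp add: V_neg_eq_cdf\<close>)
  ultimately show "(\<lambda>d. V_neg d (r d)) \<longlonglongrightarrow> Phi t"
    by (rule Lim_transform_eventually)
qed

end
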